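(* Let $p\in\mathbb{N}$ and let $\boldsymbol{U}^p$ be (strictly) positive. Then any solution $\boldsymbol{U}^{p+1}$ to the scheme satisfies $$E_{\mathcal{T}}(\boldsymbol{U}^{p+1})-E_{\mathcal{T}}(\boldsymbol{U}^p)+\Delta t_p\sum_{\sigma\in\mathcal{E}_{\rm int}}\tau_\sigma\,(D_{K\sigma}\boldsymbol{\mu}^{p+1})^TM(\boldsymbol{U}_\sigma^{p+1})\,D_{K\sigma}\boldsymbol{\mu}^{p+1}\le0,$$ where $\boldsymbol{U}_\sigma^{p+1}=(U_{i,\sigma}^{p+1})_{0\le i\le n}$. In particular, since $M(\boldsymbol{U}_\sigma^{p+1})$ is always a positive semi-definite matrix, it holds $$E_{\mathcal{T}}(\boldsymbol{U}^{p+1})\le E_{\mathcal{T}}(\boldsymbol{U}^p)\le E_{\mathcal{T}}(\boldsymbol{U}^0),$$ where $\boldsymbol{U}^0,\dots,\boldsymbol{U}^p$ are successive iterates of the scheme started from a (strictly) positive $\boldsymbol{U}^0$.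
   Context: Parameters: $n\ge1$; $\Omega\subset\mathbb{R}^d$, $d\in\{1,2,3\}$, a bounded domain; $\varepsilon,\beta>0$; $K_{ij}=K_{ji}>0$ for $0\le i\ne j\le n$. Mesh: $\Omega$ carries an admissible mesh $(\mathcal{T},\mathcal{E},(x_K)_{K\in\mathcal{T}})$. $\mathcal{T}$ is a finite set of non-empty, open, polyhedral, convex, pairwise disjoint cells with $\bigcup_K\overline K=\overline\Omega$. $\mathcal{E}$ is a set of closed faces contained in hyperplanes, of $(d-1)$-dimensional Hausdorff measure $m_\sigma>0$, with pairwise intersections of zero $(d-1)$-measure; $\partial K=\bigcup_{\sigma\in\mathcal{E}_K}\sigma$ with $\mathcal{E}_K\subset\mathcal{E}$, and $\bigcup_K\mathcal{E}_K=\mathcal{E}$; for distinct $K,L$, $\overline K\cap\overline L$ is either a single face, denoted $K|L$, or has zero $(d-1)$-measure. The centers satisfy $x_K\in K$ and $x_L-x_K\perp K|L$. $m_K$ is the Lebesgue measure of $K$; $\mathcal{E}_{\rm int}$ is the set of faces $\sigma=K|L$ and $\mathcal{E}_{K,\rm int}=\mathcal{E}_K\cap\mathcal{E}_{\rm int}$; the other faces are exterior (contained in $\partial\Omega$). For $\sigma=K|L$: $\tau_\sigma=m_\sigma/|x_K-x_L|$. For $\boldsymbol{V}=(V_K)_{K\in\mathcal{T}}$ and $\sigma\in\mathcal{E}_K$: $V_{K\sigma}=V_L$ if $\sigma=K|L$, $V_{K\sigma}=V_K$ if $\sigma$ is exterior; $D_{K\sigma}\boldsymbol{V}=V_{K\sigma}-V_K$.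 In sums over $\sigma\in\mathcal{E}_{\rm int}$ of terms quadratic in $D_{K\sigma}$, $K$ is either of the two cells adjacent to $\sigma$ (the value does not depend on the choice). Scheme: $\Delta t_p>0$ is the time step between iterates $p$ and $p+1$. Given $\boldsymbol{U}^p=(U_{i,K}^p)_{K\in\mathcal{T},0\le i\le n}$, a solution $\boldsymbol{U}^{p+1}$ satisfies, for all $K\in\mathcal{T}$, $i=0,\dots,n$, $$m_K\frac{U_{i,K}^{p+1}-U_{i,K}^p}{\Delta t_p}+\sum_{\sigma\in\mathcal{E}_{K,\rm int}}J_{i,K\sigma}^{p+1}=0,$$ where, with $\boldsymbol{U}_i=(U_{i,K})_K$, $$J_{i,K\sigma}^{p+1}=-\tau_\sigma\sum_{0\le j\ne i\le n}K_{ij}\big(U_{j,\sigma}^{p+1}D_{K\sigma}\boldsymbol{U}_i^{p+1}-U_{i,\sigma}^{p+1}D_{K\sigma}\boldsymbol{U}_j^{p+1}\big)+\tau_\sigma K_{i0}U_{i,\sigma}^{p+1}U_{0,\sigma}^{p+1}D_{K\sigma}\boldsymbol{W}_0^{p+1/2},\quad i=1,\dots,n,$$ $$J_{0,K\sigma}^{p+1}=-\tau_\sigma\sum_{i=1}^nK_{i0}\big(U_{i,\sigma}^{p+1}D_{K\sigma}\boldsymbol{U}_0^{p+1}-U_{0,\sigma}^{p+1}D_{K\sigma}\boldsymbol{U}_i^{p+1}\big)-\tau_\sigma\sum_{i=1}^nK_{i0}U_{i,\sigma}^{p+1}U_{0,\sigma}^{p+1}D_{K\sigma}\boldsymbol{W}_0^{p+1/2},$$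 $$W_{0,K}^{p+1/2}=-\frac{\varepsilon}{m_K}\sum_{\sigma\in\mathcal{E}_{K,\rm int}}\tau_\sigma D_{K\sigma}\boldsymbol{U}_0^{p+1}+\beta(1-2U_{0,K}^p),$$ and the edge values are $U_{i,\sigma}^{p+1}=0$ if $\min(U_{i,K}^{p+1},U_{i,K\sigma}^{p+1})\le0$; $U_{i,\sigma}^{p+1}=U_{i,K}^{p+1}$ if $0<U_{i,K}^{p+1}=U_{i,K\sigma}^{p+1}$; and $U_{i,\sigma}^{p+1}=\frac{U_{i,K}^{p+1}-U_{i,K\sigma}^{p+1}}{\ln U_{i,K}^{p+1}-\ln U_{i,K\sigma}^{p+1}}$ otherwise. (If $\boldsymbol{U}^p$ is positive, i.e. all $U_{i,K}^p>0$, then any solution $\boldsymbol{U}^{p+1}$ is positive, so logarithms are well defined.) Discrete chemical potentials: $\mu_{i,K}^{p+1}=\ln U_{i,K}^{p+1}$ for $i=1,\dots,n$, $\mu_{0,K}^{p+1}=\ln U_{0,K}^{p+1}+W_{0,K}^{p+1/2}$; $\boldsymbol{\mu}_i^{p+1}=(\mu_{i,K}^{p+1})_K$ and $D_{K\sigma}\boldsymbol{\mu}^{p+1}=(D_{K\sigma}\boldsymbol{\mu}_i^{p+1})_{0\le i\le n}\in\mathbb{R}^{n+1}$. Mobility: $M_{ij}(\boldsymbol{u})=-K_{ij}u_iu_j$ ($i\ne j$), $M_{ii}(\boldsymbol{u})=\sum_{0\le k\ne i\le n}K_{ik}u_iu_k$. Discrete energy: $$E_{\mathcal{T}}(\boldsymbol{V})=\sum_{i=0}^n\sum_{K\in\mathcal{T}}m_K\big(V_{i,K}\ln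 V_{i,K}-V_{i,K}+1\big)+\frac{\varepsilon}{2}\sum_{\sigma\in\mathcal{E}_{\rm int},\,\sigma=K|L}\tau_\sigma|D_{K\sigma}\boldsymbol{V}_0|^2+\beta\sum_{K\in\mathcal{T}}m_KV_{0,K}(1-V_{0,K}).$$ Initialization: $U^0_{i,K}=\frac1{m_K}\int_Ku_i^0\,dx$ for an initial datum $\boldsymbol{u}^0=(u_0^0,\dots,u_n^0)$ with $u_i^0\in L^\infty(\Omega)$, $u_i^0\ge0$, $\sum_{i=0}^nu_i^0=1$ a.e., $\int_\Omega u_i^0\,dx=m_i>0$ given masses with $\sum_i m_i=|\Omega|$, and $u_0^0\in H^1(\Omega)$. *)

theory Defs
  imports "HOL-Analysis.Analysis"
begin

subsection \<open>Hausdorff measure\<close>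

text \<open>The normalisation by \<^term>\<open>unit_ball_vol\<close> makes the \<open>s\<close>-dimensional measure agree with Lebesgue
  measure on \<open>s\<close>-dimensional affine subspaces; for \<open>s = 0\<close> it is the counting measure, since
  \<open>0 ^ 0 = 1\<close> and empty covering sets contribute nothing.\<close>

definition hausdorff_content :: "nat \<Rightarrow> real \<Rightarrow> 'a::euclidean_space set \<Rightarrow> ennreal" where
  "hausdorff_content s \<delta> A =
     (INF C \<in> {C :: nat \<Rightarrow> 'a set. A \<subseteq> (\<Union>i. C i) \<and> (\<forall>i. bounded (C i) \<and> diameter (C i) \<le> \<delta>)}.
        \<Sum>i. if C i = {} then 0 else ennreal (unit_ball_vol (real s) * (diameter (C i) / 2) ^ s))"

definition hausdorff_measure :: "nat \<Rightarrow> 'a::euclidean_space set \<Rightarrow> ennreal" where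
  "hausdorff_measure s A = (SUP \<delta> \<in> {0<..}. hausdorff_content s \<delta> A)"


subsection \<open>Admissible meshes\<close>

text \<open>Cells and faces are point sets; \<open>cell_faces m K\<close> is \<open>\<E>\<^sub>K\<close> and \<open>center m K\<close> is \<open>x\<^sub>K\<close>.\<close>

record 'a mesh =
  cells :: "'a set set"
  faces :: "'a set set"
  cell_faces :: "'a set \<Rightarrow> 'a set set"
  center :: "'a set \<Rightarrow> 'a"

text \<open>\<open>\<sigma> = K|L\<close>.\<close>

definition is_interface ::
    "('a::euclidean_space) mesh \<Rightarrow> 'a set \<Rightarrow> 'a set \<Rightarrow> 'a set \<Rightarrow> bool" where
  "is_interface m K L \<sigma> \<longleftrightarrow>
     K \<in> cells m \<and> L \<in> cells m \<and> K \<noteq> L \<and> \<sigma> \<in> faces m \<and> \<sigma> = closure K \<inter> closure L"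

definition int_faces :: "('a::euclidean_space) mesh \<Rightarrow> 'a set set" where
  "int_faces m = {\<sigma>. \<exists>K L. is_interface m K L \<sigma>}"

definition int_cell_faces :: "('a::euclidean_space) mesh \<Rightarrow> 'a set \<Rightarrow> 'a set set" where
  "int_cell_faces m K = cell_faces m K \<inter> int_faces m"

definition cell_measure :: "('a::euclidean_space) set \<Rightarrow> real" where
  "cell_measure K = measure lebesgue K"

definition face_measure :: "('a::euclidean_space) set \<Rightarrow> real" where
  "face_measure \<sigma> = enn2real (hausdorff_measure (DIM('a) - 1) \<sigma>)"

definition bounded_domain :: "('a::euclidean_space) set \<Rightarrow> bool" where
  "bounded_domain \<Omega> \<longleftrightarrow> open \<Omega> \<and> connected \<Omega> \<and> \<Omega> \<noteq> {} \<and> bounded \<Omega>"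

text \<open>The library's \<^const>\<open>polyhedron\<close> is a finite intersection of closed half-spaces, so an open
  convex cell is polyhedral iff its closure is a polyhedron. The measure \<^const>\<open>face_measure\<close> is
  0 for sets of infinite Hausdorff measure; faces are closed subsets of the bounded sets \<open>\<partial>K\<close> and
  contained in hyperplanes, so this convention does not affect them. The common face \<open>K|L\<close> is
  required to lie in \<open>\<E>\<^sub>K\<close> and \<open>\<E>\<^sub>L\<close>: it is contained in \<open>\<partial>K = \<Union>\<E>\<^sub>K\<close> and meets every other face in a
  null set.\<close>

definition admissible_mesh :: "('a::euclidean_space) set \<Rightarrow> 'a mesh \<Rightarrow> bool" where
  "admissible_mesh \<Omega> m \<longleftrightarrow>
     finite (cells m) \<and>
     (\<forall>K\<in>cells m. K \<noteq> {} \<and> open K \<and> convex K \<and> polyhedron (closure K)) \<and>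
     disjoint (cells m) \<and>
     (\<Union>K\<in>cells m. closure K) = closure \<Omega> \<and>
     (\<forall>\<sigma>\<in>faces m. closed \<sigma> \<and> (\<exists>a b. a \<noteq> 0 \<and> \<sigma> \<subseteq> {x. a \<bullet> x = b}) \<and> 0 < face_measure \<sigma>) \<and>
     (\<forall>\<sigma>\<in>faces m. \<forall>\<sigma>'\<in>faces m. \<sigma> \<noteq> \<sigma>' \<longrightarrow> hausdorff_measure (DIM('a) - 1) (\<sigma> \<inter> \<sigma>') = 0) \<and>
     (\<forall>K\<in>cells m. cell_faces m K \<subseteq> faces m \<and> frontier K = \<Union> (cell_faces m K)) \<and>
     (\<Union>K\<in>cells m. cell_faces m K) = faces m \<and>
     (\<forall>K\<in>cells m. \<forall>L\<in>cells m. K \<noteq> L \<longrightarrow>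
        closure K \<inter> closure L \<in> cell_faces m K \<inter> cell_faces m L \<or>
        hausdorff_measure (DIM('a) - 1) (closure K \<inter> closure L) = 0) \<and>
     (\<forall>\<sigma>\<in>faces m - int_faces m. \<sigma> \<subseteq> frontier \<Omega>) \<and>
     (\<forall>K\<in>cells m. center m K \<in> K) \<and>
     (\<forall>K L \<sigma>. is_interface m K L \<sigma> \<longrightarrow>
        (\<forall>y\<in>\<sigma>. \<forall>z\<in>\<sigma>. (center m L - center m K) \<bullet> (y - z) = 0))"

definition opposite_cell :: "('a::euclidean_space) mesh \<Rightarrow> 'a set \<Rightarrow> 'a set \<Rightarrow> 'a set" where
  "opposite_cell m K \<sigma> = (THE L. is_interface m K L \<sigma>)"

text \<open>An arbitrary choice of one of the two cells adjacent to an interior face; the quantities built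
  with it below do not depend on the choice.\<close>

definition adjacent_cell :: "('a::euclidean_space) mesh \<Rightarrow> 'a set \<Rightarrow> 'a set" where
  "adjacent_cell m \<sigma> = (SOME K. \<exists>L. is_interface m K L \<sigma>)"

definition transmissibility :: "('a::euclidean_space) mesh \<Rightarrow> 'a set \<Rightarrow> real" where
  "transmissibility m \<sigma> =
     (let K = adjacent_cell m \<sigma>
      in face_measure \<sigma> / norm (center m K - center m (opposite_cell m K \<sigma>)))"


subsection \<open>Discrete operators\<close>

text \<open>\<open>V\<^sub>K\<^sub>\<sigma>\<close> and \<open>D\<^sub>K\<^sub>\<sigma>V\<close> for a cell-wise function \<open>V\<close>.\<close>

definition face_value ::
    "('a::euclidean_space) mesh \<Rightarrow> ('a set \<Rightarrow> real) \<Rightarrow> 'a set \<Rightarrow> 'a set \<Rightarrow> real" where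
  "face_value m V K \<sigma> =
     (if \<exists>L. is_interface m K L \<sigma> then V (opposite_cell m K \<sigma>) else V K)"

definition face_diff ::
    "('a::euclidean_space) mesh \<Rightarrow> ('a set \<Rightarrow> real) \<Rightarrow> 'a set \<Rightarrow> 'a set \<Rightarrow> real" where
  "face_diff m V K \<sigma> = face_value m V K \<sigma> - V K"

definition log_mean :: "real \<Rightarrow> real \<Rightarrow> real" where
  "log_mean a b =
     (if min a b \<le> 0 then 0 else if a = b then a else (a - b) / (ln a - ln b))"

text \<open>\<open>V\<^sub>\<sigma>\<close>, computed from the side of \<open>K\<close>.\<close>

definition edge_value ::
    "('a::euclidean_space) mesh \<Rightarrow> ('a set \<Rightarrow> real) \<Rightarrow> 'a set \<Rightarrow> 'a set \<Rightarrow> real" where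
  "edge_value m V K \<sigma> = log_mean (V K) (face_value m V K \<sigma>)"


subsection \<open>The scheme\<close>

text \<open>Discrete states are \<open>U :: nat \<Rightarrow> 'a set \<Rightarrow> real\<close> with \<open>U i K = U\<^sub>i\<^sub>,\<^sub>K\<close>, relevant only for \<open>i \<le> n\<close> and
  \<open>K\<close> a cell; \<open>\<kappa> i j\<close> stands for \<open>K\<^sub>i\<^sub>j\<close>.\<close>

definition positive_state ::
    "('a::euclidean_space) mesh \<Rightarrow> nat \<Rightarrow> (nat \<Rightarrow> 'a set \<Rightarrow> real) \<Rightarrow> bool" where
  "positive_state m n U \<longleftrightarrow> (\<forall>i\<le>n. \<forall>K\<in>cells m. 0 < U i K)"

text \<open>\<open>U\<close> is the old iterate \<open>U\<^sup>p\<close> and \<open>U'\<close> the new one \<open>U\<^sup>p\<^sup>+\<^sup>1\<close>.\<close>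

definition potential_W ::
    "('a::euclidean_space) mesh \<Rightarrow> real \<Rightarrow> real \<Rightarrow> (nat \<Rightarrow> 'a set \<Rightarrow> real) \<Rightarrow>
     (nat \<Rightarrow> 'a set \<Rightarrow> real) \<Rightarrow> 'a set \<Rightarrow> real" where
  "potential_W m \<epsilon> \<beta> U U' K =
     - (\<epsilon> / cell_measure K) *
         (\<Sum>\<sigma>\<in>int_cell_faces m K. transmissibility m \<sigma> * face_diff m (U' 0) K \<sigma>)
     + \<beta> * (1 - 2 * U 0 K)"

definition flux ::
    "('a::euclidean_space) mesh \<Rightarrow> nat \<Rightarrow> (nat \<Rightarrow> nat \<Rightarrow> real) \<Rightarrow> real \<Rightarrow> real \<Rightarrow>
     (nat \<Rightarrow> 'a set \<Rightarrow> real) \<Rightarrow> (nat \<Rightarrow> 'a set \<Rightarrow> real) \<Rightarrow> nat \<Rightarrow> 'a set \<Rightarrow> 'a set \<Rightarrow> real" where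
  "flux m n \<kappa> \<epsilon> \<beta> U U' i K \<sigma> =
     (let \<tau> = transmissibility m \<sigma>;
          u = (\<lambda>j. edge_value m (U' j) K \<sigma>);
          D = (\<lambda>j. face_diff m (U' j) K \<sigma>);
          DW = face_diff m (potential_W m \<epsilon> \<beta> U U') K \<sigma>
      in if i = 0
         then - \<tau> * (\<Sum>j=1..n. \<kappa> j 0 * (u j * D 0 - u 0 * D j))
              - \<tau> * (\<Sum>j=1..n. \<kappa> j 0 * u j * u 0 * DW)
         else - \<tau> * (\<Sum>j\<in>{0..n} - {i}. \<kappa> i j * (u j * D i - u i * D j))
              + \<tau> * \<kappa> i 0 * u i * u 0 * DW)"

definition scheme_step ::
    "('a::euclidean_space) mesh \<Rightarrow> nat \<Rightarrow> (nat \<Rightarrow> nat \<Rightarrow> real) \<Rightarrow> real \<Rightarrow> real \<Rightarrow> real \<Rightarrow>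
     (nat \<Rightarrow> 'a set \<Rightarrow> real) \<Rightarrow> (nat \<Rightarrow> 'a set \<Rightarrow> real) \<Rightarrow> bool" where
  "scheme_step m n \<kappa> \<epsilon> \<beta> dt U U' \<longleftrightarrow>
     (\<forall>K\<in>cells m. \<forall>i\<le>n.
        cell_measure K * ((U' i K - U i K) / dt)
        + (\<Sum>\<sigma>\<in>int_cell_faces m K. flux m n \<kappa> \<epsilon> \<beta> U U' i K \<sigma>) = 0)"

definition chem_potential ::
    "('a::euclidean_space) mesh \<Rightarrow> real \<Rightarrow> real \<Rightarrow> (nat \<Rightarrow> 'a set \<Rightarrow> real) \<Rightarrow>
     (nat \<Rightarrow> 'a set \<Rightarrow> real) \<Rightarrow> nat \<Rightarrow> 'a set \<Rightarrow> real" where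
  "chem_potential m \<epsilon> \<beta> U U' i K =
     (if i = 0 then ln (U' 0 K) + potential_W m \<epsilon> \<beta> U U' K else ln (U' i K))"


subsection \<open>Mobility and energy\<close>

text \<open>\<open>(n+1) \<times> (n+1)\<close> matrices are functions on \<open>{0..n} \<times> {0..n}\<close>.\<close>

definition mobility :: "nat \<Rightarrow> (nat \<Rightarrow> nat \<Rightarrow> real) \<Rightarrow> (nat \<Rightarrow> real) \<Rightarrow> nat \<Rightarrow> nat \<Rightarrow> real" where
  "mobility n \<kappa> u i j =
     (if i = j then (\<Sum>k\<in>{0..n} - {i}. \<kappa> i k * u i * u k) else - \<kappa> i j * u i * u j)"

definition quad_form :: "nat \<Rightarrow> (nat \<Rightarrow> nat \<Rightarrow> real) \<Rightarrow> (nat \<Rightarrow> real) \<Rightarrow> real" where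
  "quad_form n A z = (\<Sum>i=0..n. \<Sum>j=0..n. z i * A i j * z j)"

definition pos_semidef :: "nat \<Rightarrow> (nat \<Rightarrow> nat \<Rightarrow> real) \<Rightarrow> bool" where
  "pos_semidef n A \<longleftrightarrow>
     (\<forall>i\<le>n. \<forall>j\<le>n. A i j = A j i) \<and> (\<forall>z. 0 \<le> quad_form n A z)"

definition edge_state ::
    "('a::euclidean_space) mesh \<Rightarrow> (nat \<Rightarrow> 'a set \<Rightarrow> real) \<Rightarrow> 'a set \<Rightarrow> nat \<Rightarrow> real" where
  "edge_state m U \<sigma> i = edge_value m (U i) (adjacent_cell m \<sigma>) \<sigma>"

definition discrete_energy ::
    "('a::euclidean_space) mesh \<Rightarrow> nat \<Rightarrow> real \<Rightarrow> real \<Rightarrow> (nat \<Rightarrow> 'a set \<Rightarrow> real) \<Rightarrow> real" where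
  "discrete_energy m n \<epsilon> \<beta> V =
     (\<Sum>i=0..n. \<Sum>K\<in>cells m. cell_measure K * (V i K * ln (V i K) - V i K + 1))
     + \<epsilon> / 2 * (\<Sum>\<sigma>\<in>int_faces m.
         transmissibility m \<sigma> * \<bar>face_diff m (V 0) (adjacent_cell m \<sigma>) \<sigma>\<bar>\<^sup>2)
     + \<beta> * (\<Sum>K\<in>cells m. cell_measure K * V 0 K * (1 - V 0 K))"

definition discrete_dissipation ::
    "('a::euclidean_space) mesh \<Rightarrow> nat \<Rightarrow> (nat \<Rightarrow> nat \<Rightarrow> real) \<Rightarrow> real \<Rightarrow> real \<Rightarrow>
     (nat \<Rightarrow> 'a set \<Rightarrow> real) \<Rightarrow> (nat \<Rightarrow> 'a set \<Rightarrow> real) \<Rightarrow> real" where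
  "discrete_dissipation m n \<kappa> \<epsilon> \<beta> U U' =
     (\<Sum>\<sigma>\<in>int_faces m. transmissibility m \<sigma> *
        quad_form n (mobility n \<kappa> (edge_state m U' \<sigma>))
          (\<lambda>i. face_diff m (chem_potential m \<epsilon> \<beta> U U' i) (adjacent_cell m \<sigma>) \<sigma>))"

end

theory Submission
  imports Defs
begin

text \<open>
  The energy decreases because the scheme is a discrete gradient flow. Write \<open>\<mu>\<^sub>i\<close> for the discrete chemical
  potentials and call \<open>\<Sum> m\<^sub>K (U'\<^sub>i\<^sub>,\<^sub>K - U\<^sub>i\<^sub>,\<^sub>K) \<mu>\<^sub>i\<^sub>,\<^sub>K\<close> (over all \<open>i\<close> and \<open>K\<close>) the work of a step from \<open>U\<close> to
  \<open>U'\<close>. The work is compared with the two other quantities in the inequality.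

  It equals minus the time step times the dissipation (\<open>work_eq_dissipation\<close>): multiply the scheme by \<open>\<mu>\<^sub>i\<^sub>,\<^sub>K\<close>
  and sum by parts. Since the edge values are logarithmic means, \<open>U\<^sub>i\<^sub>,\<^sub>\<sigma>\<close> times the jump of \<open>ln U\<^sub>i\<close> is exactly the
  jump of \<open>U\<^sub>i\<close>, so the fluxes are \<open>- \<tau>\<^sub>\<sigma> M(U\<^sub>\<sigma>) D\<mu>\<close> (\<open>flux_eq_mobility\<close>).

  It bounds the energy increment from above (\<open>energy_increment_le_work\<close>): the entropy and the gradient energy are
  convex and enter \<open>\<mu>\<close> through their derivatives at the new state, while the remaining concave term enters through
  its derivative at the old state.

  These arguments take logarithms of the new state, which is therefore first shown to be positive by a minimum
  principle (\<open>scheme_step_positive\<close>). The matrix \<open>M\<close> is positive semi-definite because its quadratic form is a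
  weighted sum of the squares \<open>(z\<^sub>i - z\<^sub>j)\<^sup>2\<close> (\<open>quad_form_mobility\<close>), so the energy decreases in each step.

  Summation by parts requires that an interior face belong to exactly two cells, which has to be derived from the
  geometry of the mesh (\<open>interface_third_cell\<close>). A face lies in a hyperplane and is convex; its positive
  \<open>(d-1)\<close>-dimensional Hausdorff measure forces it to have dimension \<open>d - 1\<close>, because sets of smaller dimension
  are null. Two of three cells adjacent to it would then lie on the same side of the hyperplane and overlap.
\<close>

section \<open>Hausdorff measure of low-dimensional sets\<close>

lemma hausdorff_content_le_finite_cover:
  fixes A :: "'a::euclidean_space set"
  assumes "finite I" and cover: "A \<subseteq> (\<Union>i\<in>I. F i)"
    and bdd: "\<And>i. i \<in> I \<Longrightarrow> bounded (F i)"
    and diam: "\<And>i. i \<in> I \<Longrightarrow> diameter (F i) \<le> r"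
    and r: "0 \<le> r" "r \<le> \<delta>"
  shows "hausdorff_content s \<delta> A \<le> ennreal (real (card I) * (unit_ball_vol (real s) * (r / 2) ^ s))"
proof -
  obtain h where h: "bij_betw h {0..<card I} I"
    using ex_bij_betw_nat_finite[OF \<open>finite I\<close>] by blast
  define C where "C = (\<lambda>i. if i < card I then F (h i) else {})"
  have hI: "h i \<in> I" if "i < card I" for i
    using h that by (auto simp: bij_betw_def)
  have "(\<Union>i\<in>I. F i) \<subseteq> (\<Union>i. C i)"
  proof
    fix x assume "x \<in> (\<Union>i\<in>I. F i)"
    then obtain i where "i \<in> I" "x \<in> F i" by blast
    moreover obtain j where "j < card I" "h j = i"
      using h \<open>i \<in> I\<close> by (metis atLeastLessThan_iff bij_betw_iff_bijections)
    ultimately have "j < card I" "x \<in> F (h j)" by auto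
    then have "x \<in> C j" by (simp add: C_def)
    then show "x \<in> (\<Union>i. C i)" by blast
  qed
  moreover have "bounded (C i) \<and> diameter (C i) \<le> \<delta>" for i
    using bdd[OF hI] diam[OF hI] r by (force simp: C_def)
  ultimately have "hausdorff_content s \<delta> A \<le>
      (\<Sum>i. if C i = {} then 0 else ennreal (unit_ball_vol (real s) * (diameter (C i) / 2) ^ s))"
    unfolding hausdorff_content_def using cover by (intro INF_lower) auto
  also have "\<dots> = (\<Sum>i<card I. if C i = {} then 0 else ennreal (unit_ball_vol (real s) * (diameter (C i) / 2) ^ s))"
    by (intro suminf_finite) (auto simp: C_def)
  also have "\<dots> \<le> (\<Sum>i<card I. ennreal (unit_ball_vol (real s) * (r / 2) ^ s))"
  proof (intro sum_mono)
    fix i assume i: "i \<in> {..<card I}"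
    then have "(diameter (C i) / 2) ^ s \<le> (r / 2) ^ s"
      using diam[OF hI] bdd[OF hI] by (intro power_mono) (auto simp: C_def diameter_ge_0)
    then show "(if C i = {} then 0 else ennreal (unit_ball_vol (real s) * (diameter (C i) / 2) ^ s))
        \<le> ennreal (unit_ball_vol (real s) * (r / 2) ^ s)"
      by (auto intro!: ennreal_leI mult_left_mono)
  qed
  also have "\<dots> = ennreal (real (card I) * (unit_ball_vol (real s) * (r / 2) ^ s))"
    by (simp add: ennreal_mult' ennreal_of_nat_eq_real_of_nat)
  finally show ?thesis .
qed

text \<open>A bounded set of dimension \<open>k\<close> is covered by a constant times \<open>N ^ k\<close> pieces of diameter at most
  \<open>k / N\<close>, whose \<open>s\<close>-th powers sum to at most a constant times \<open>N ^ k / N ^ s\<close>. This tends to \<open>0\<close>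
  as soon as \<open>k < s\<close>.\<close>
lemma hausdorff_measure_eq_0_if_aff_dim_less:
  fixes A :: "'a::euclidean_space set"
  assumes "bounded A" and dimA: "aff_dim A < int s"
  shows "hausdorff_measure s A = 0"
proof -
  have "hausdorff_content s \<delta> A \<le> 0" if "\<delta> > 0" for \<delta>
  proof (cases "A = {}")
    case True
    then show ?thesis
      using hausdorff_content_le_finite_cover[of "{}" A "\<lambda>_. {}" 0 \<delta> s] that by simp
  next
    case False
    then obtain x where x: "x \<in> A" by blast
    define S where "S = (\<lambda>y. y - x) ` A"
    have "aff_dim A = int (dim ((+) (- x) ` A))"
      using x by (intro aff_dim_eq_dim) (simp add: hull_inc)
    also have "(+) (- x) ` A = S" by (auto simp: S_def)
    finally have dimS: "dim S < s" using dimA by simp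
    obtain B where B: "B \<subseteq> span S" "pairwise orthogonal B" "\<And>b. b \<in> B \<Longrightarrow> norm b = 1"
        "independent B" "card B = dim (span S)" "span B = span S"
      using orthonormal_basis_subspace[of "span S"] by (metis subspace_span)
    have finB: "finite B" using B(4) by (rule independent_imp_finite)
    define k where "k = card B"
    have k: "k < s" using B(5) dimS by (simp add: k_def dim_span)
    obtain R' where R': "\<And>y. y \<in> A \<Longrightarrow> dist x y \<le> R'"
      using \<open>bounded A\<close> by (meson bounded_any_center)
    define R where "R = nat \<lceil>R'\<rceil>"
    have R: "norm (y - x) \<le> real R" if "y \<in> A" for y
      using R'[OF that] unfolding R_def by (simp add: dist_norm norm_minus_commute) linarith
    define c where "c = real (2 * R + 1) ^ k * (unit_ball_vol (real s) * (real k / 2) ^ s)"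
    have c0: "c \<ge> 0" by (simp add: c_def)
    have bound: "hausdorff_content s \<delta> A \<le> ennreal (c / real N)"
      if N: "N > 0" "real k / real N \<le> \<delta>" for N
    proof -
      \<comment> \<open>The pieces are the level sets of the integer parts of \<open>N\<close> times the coordinates with respect to \<open>B\<close>.\<close>
      define g where "g = (\<lambda>y. \<lambda>b\<in>B. \<lfloor>real N * ((y - x) \<bullet> b)\<rfloor>)"
      define I where "I = B \<rightarrow>\<^sub>E {- int (N * R)..int (N * R)}"
      define F where "F = (\<lambda>j. {y \<in> A. g y = j})"
      have finI: "finite I" unfolding I_def by (intro finite_PiE finB) simp
      have gI: "g y \<in> I" if y: "y \<in> A" for y
      proof -
        have "\<lfloor>real N * ((y - x) \<bullet> b)\<rfloor> \<in> {- int (N * R)..int (N * R)}" if "b \<in> B" for b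
        proof -
          have "\<bar>(y - x) \<bullet> b\<bar> \<le> norm (y - x) * norm b" by (rule Cauchy_Schwarz_ineq2)
          also have "\<dots> \<le> real R" using R[OF y] B(3)[OF that] by simp
          finally have "\<bar>real N * ((y - x) \<bullet> b)\<bar> \<le> real N * real R"
            by (simp add: abs_mult mult_left_mono)
          then have "- real_of_int (int (N * R)) \<le> real N * ((y - x) \<bullet> b)"
              "real N * ((y - x) \<bullet> b) \<le> real_of_int (int (N * R))"
            by (auto simp: abs_le_iff)
          then show ?thesis
            by (simp add: le_floor_iff floor_le_iff del: of_nat_mult)
        qed
        then show ?thesis by (auto simp: g_def I_def)
      qed
      have diam: "diameter (F j) \<le> real k / real N" for j
      proof (rule diameter_le)
        fix y z assume "y \<in> F j" "z \<in> F j"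
        then have yz: "y \<in> A" "z \<in> A" "g y = g z" by (auto simp: F_def)
        have "y - z = (y - x) - (z - x)" by simp
        also have "\<dots> \<in> span S"
          using yz by (intro span_diff span_base) (auto simp: S_def)
        finally have "(\<Sum>b\<in>B. ((y - z) \<bullet> b) *\<^sub>R b) = y - z"
          using B finB by (intro orthonormal_basis_expand) auto
        then have "norm (y - z) = norm (\<Sum>b\<in>B. ((y - z) \<bullet> b) *\<^sub>R b)" by simp
        also have "\<dots> \<le> (\<Sum>b\<in>B. norm (((y - z) \<bullet> b) *\<^sub>R b))" by (rule norm_sum)
        also have "\<dots> \<le> (\<Sum>b\<in>B. 1 / real N)"
        proof (rule sum_mono)
          fix b assume b: "b \<in> B"
          have "\<lfloor>real N * ((y - x) \<bullet> b)\<rfloor> = \<lfloor>real N * ((z - x) \<bullet> b)\<rfloor>"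
            using fun_cong[OF yz(3), of b] b by (simp add: g_def)
          then have "\<bar>real N * ((y - x) \<bullet> b) - real N * ((z - x) \<bullet> b)\<bar> \<le> 1" by linarith
          also have "real N * ((y - x) \<bullet> b) - real N * ((z - x) \<bullet> b) = real N * ((y - z) \<bullet> b)"
            by (simp add: algebra_simps)
          finally show "norm (((y - z) \<bullet> b) *\<^sub>R b) \<le> 1 / real N"
            using B(3)[OF b] N by (simp add: abs_mult field_simps)
        qed
        finally show "norm (y - z) \<le> real k / real N" by (simp add: k_def)
      qed simp
      have "card {- int (N * R)..int (N * R)} = 2 * (N * R) + 1"
        unfolding card_atLeastAtMost_int by linarith
      then have cardI: "card I = (2 * (N * R) + 1) ^ k"
        unfolding I_def k_def using finB by (subst card_PiE) simp_all
      have "hausdorff_content s \<delta> A \<le>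
          ennreal (real (card I) * (unit_ball_vol (real s) * (real k / real N / 2) ^ s))"
        using gI N(2) \<open>bounded A\<close>
        by (intro hausdorff_content_le_finite_cover[where F=F] finI diam)
           (auto simp: F_def intro: bounded_subset)
      also have "\<dots> \<le> ennreal (c / real N)"
      proof (rule ennreal_leI)
        have "real (card I) \<le> (real N * real (2 * R + 1)) ^ k"
        proof -
          have "2 * (N * R) + 1 \<le> N * (2 * R + 1)" using N(1) by (simp add: algebra_simps)
          then have "card I \<le> (N * (2 * R + 1)) ^ k" unfolding cardI by (intro power_mono) auto
          then show ?thesis by (metis of_nat_le_iff of_nat_mult of_nat_power)
        qed
        then have "real (card I) * (unit_ball_vol (real s) * (real k / real N / 2) ^ s)
            \<le> (real N * real (2 * R + 1)) ^ k * (unit_ball_vol (real s) * (real k / real N / 2) ^ s)"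
          by (intro mult_right_mono) auto
        also have "\<dots> = c * (real N ^ k / real N ^ s)"
          by (simp add: c_def power_mult_distrib power_divide mult_ac)
        also have "\<dots> \<le> c * (1 / real N)"
        proof (rule mult_left_mono[OF _ c0])
          have "real N ^ Suc k \<le> real N ^ s" using N k by (intro power_increasing) auto
          then show "real N ^ k / real N ^ s \<le> 1 / real N" using N(1) by (simp add: field_simps)
        qed
        finally show "real (card I) * (unit_ball_vol (real s) * (real k / real N / 2) ^ s) \<le> c / real N"
          by simp
      qed
      finally show ?thesis .
    qed
    have "(\<lambda>N. real k / real N) \<longlonglongrightarrow> 0" by (rule lim_const_over_n)
    then have "\<forall>\<^sub>F N in sequentially. real k / real N < \<delta>"
      using that by (rule order_tendstoD)
    then have ev: "\<forall>\<^sub>F N in sequentially. hausdorff_content s \<delta> A \<le> ennreal (c / real N)"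
      using eventually_gt_at_top[of 0] by eventually_elim (intro bound, auto)
    have "(\<lambda>N. ennreal (c / real N)) \<longlonglongrightarrow> ennreal 0"
      by (intro tendsto_ennrealI lim_const_over_n)
    then have "hausdorff_content s \<delta> A \<le> ennreal 0"
      by (rule tendsto_lowerbound[OF _ ev]) simp
    then show ?thesis by simp
  qed
  then show ?thesis
    unfolding hausdorff_measure_def by (simp add: SUP_le_iff flip: le_zero_eq)
qed

section \<open>Convex sets with a common face\<close>

text \<open>Near a relative interior point \<open>y\<close> of \<open>F\<close>, each of the two convex sets contains a half-ball on the
  positive side of the hyperplane. To turn this into a formula, move from \<open>y\<close> towards \<open>a\<close> by a small
  \<open>t\<close>; the point so obtained lies in \<open>A\<close>. It also lies on the segment from \<open>b\<close> to the point \<open>z t\<close> of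
  the hyperplane, which is close to \<open>y\<close> and hence in \<open>F\<close>; so it lies in \<open>B\<close> as well.\<close>
lemma open_convex_same_side_overlap:
  fixes A B :: "'a::euclidean_space set"
  assumes A: "open A" "convex A" "a \<in> A" "w \<bullet> a > c"
    and B: "open B" "convex B" "b \<in> B" "w \<bullet> b > c"
    and F: "convex F" "F \<subseteq> closure A" "F \<subseteq> closure B" "F \<subseteq> {x. w \<bullet> x = c}"
    and dimF: "aff_dim F = int DIM('a) - 1"
  shows "A \<inter> B \<noteq> {}"
proof -
  have "F \<noteq> {}"
  proof
    assume "F = {}"
    then have "int DIM('a) = 0" using dimF by simp
    then show False using DIM_positive[where 'a='a] by simp
  qed
  have w0: "w \<noteq> 0" using A(4) F(4) \<open>F \<noteq> {}\<close> by auto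
  have hull: "affine hull F = {x. w \<bullet> x = c}"
  proof (rule affine_dim_equal)
    show "affine hull F \<subseteq> {x. w \<bullet> x = c}"
      using F(4) by (intro hull_minimal affine_hyperplane)
  qed (use \<open>F \<noteq> {}\<close> dimF w0 in \<open>auto simp: affine_hyperplane aff_dim_affine_hull aff_dim_hyperplane\<close>)
  obtain y where "y \<in> rel_interior F"
    using \<open>F \<noteq> {}\<close> F(1) by (meson rel_interior_eq_empty ex_in_conv)
  then obtain e where y: "y \<in> F" and e: "e > 0" and ball: "ball y e \<inter> {x. w \<bullet> x = c} \<subseteq> F"
    unfolding mem_rel_interior_ball hull by blast
  have wy: "w \<bullet> y = c" using y F(4) by auto
  \<comment> \<open>The ratio of the heights of \<open>a\<close> and \<open>b\<close> above the hyperplane: moving by \<open>t\<close> towards \<open>a\<close> gains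
    as much height as moving by \<open>t * q\<close> towards \<open>b\<close>.\<close>
  define q where "q = (w \<bullet> a - c) / (w \<bullet> b - c)"
  have q: "q > 0" using A(4) B(4) by (simp add: q_def)
  define z where "z = (\<lambda>t. (1 / (1 - t * q)) *\<^sub>R (y + t *\<^sub>R (a - y) - (t * q) *\<^sub>R b))"
  have "(z \<longlongrightarrow> (1 / (1 - 0 * q)) *\<^sub>R (y + 0 *\<^sub>R (a - y) - (0 * q) *\<^sub>R b)) (at_right 0)"
    unfolding z_def by (intro tendsto_intros) auto
  then have "(z \<longlongrightarrow> y) (at_right 0)" by simp
  then have "\<forall>\<^sub>F t in at_right 0. dist (z t) y < e" using e by (rule tendstoD)
  moreover have "\<forall>\<^sub>F t in at_right 0. (t::real) \<in> {0<..<min 1 (1 / q)}"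
    using q by (intro eventually_at_right_real) auto
  ultimately have "\<forall>\<^sub>F t in at_right (0::real). dist (z t) y < e \<and> t \<in> {0<..<min 1 (1 / q)}"
    by eventually_elim auto
  then obtain t where t: "dist (z t) y < e" "0 < t" "t < 1" "t * q < 1"
    using q eventually_happens[of _ "at_right (0::real)"] by (auto simp: field_simps)
  have "w \<bullet> z t = c"
  proof -
    have "w \<bullet> (y + t *\<^sub>R (a - y) - (t * q) *\<^sub>R b) = c + t * (w \<bullet> a - c) - t * q * (w \<bullet> b)"
      by (simp add: inner_simps wy algebra_simps)
    also have "w \<bullet> a - c = q * (w \<bullet> b - c)" using B(4) by (simp add: q_def)
    finally have "w \<bullet> (y + t *\<^sub>R (a - y) - (t * q) *\<^sub>R b) = (1 - t * q) * c"
      by (simp add: algebra_simps)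
    then show ?thesis using t by (simp add: z_def)
  qed
  then have zF: "z t \<in> F" using ball t(1) by (auto simp: dist_commute)
  have "(1 - t * q) *\<^sub>R z t = y + t *\<^sub>R (a - y) - (t * q) *\<^sub>R b"
    using t by (simp add: z_def)
  then have eq: "z t - (t * q) *\<^sub>R (z t - b) = y - t *\<^sub>R (y - a)"
    by (simp add: algebra_simps)
  have "y - t *\<^sub>R (y - a) \<in> interior A"
    using A t y F(2) by (intro mem_interior_closure_convex_shrink) (auto simp: interior_open)
  moreover have "z t - (t * q) *\<^sub>R (z t - b) \<in> interior B"
    using B t q zF F(3) by (intro mem_interior_closure_convex_shrink) (auto simp: interior_open)
  ultimately show ?thesis using eq interior_subset by (metis disjoint_iff subset_iff)
qed

text \<open>A hyperplane has two sides only, so two of three convex sets sharing a piece of it lie on the same side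
  near that piece.\<close>
lemma three_open_convex_overlap:
  fixes F :: "'a::euclidean_space set"
  assumes opn: "open A" "open B" "open C" and cvx: "convex A" "convex B" "convex C"
    and ne: "A \<noteq> {}" "B \<noteq> {}" "C \<noteq> {}"
    and F: "convex F" "F \<subseteq> closure A" "F \<subseteq> closure B" "F \<subseteq> closure C" "F \<subseteq> {x. w \<bullet> x = c}" "w \<noteq> 0"
    and dimF: "aff_dim F = int DIM('a) - 1"
  shows "A \<inter> B \<noteq> {} \<or> A \<inter> C \<noteq> {} \<or> B \<inter> C \<noteq> {}"
proof -
  have off: "\<exists>x\<in>X. w \<bullet> x \<noteq> c" if "open X" "X \<noteq> {}" for X :: "'a set"
  proof (rule ccontr)
    assume "\<not> ?thesis"
    then have "X \<subseteq> interior {x. w \<bullet> x = c}" using \<open>open X\<close> by (intro interior_maximal) auto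
    then show False using \<open>X \<noteq> {}\<close> \<open>w \<noteq> 0\<close> by (simp add: interior_hyperplane)
  qed
  obtain x y z where "x \<in> A" "w \<bullet> x \<noteq> c" "y \<in> B" "w \<bullet> y \<noteq> c" "z \<in> C" "w \<bullet> z \<noteq> c"
    using off opn ne by meson
  note pts = this
  have neg: "F \<subseteq> {x. (- w) \<bullet> x = - c}" using F(5) by auto
  have same: "X \<inter> Y \<noteq> {}"
    if "open X" "convex X" "p \<in> X" "open Y" "convex Y" "r \<in> Y" "F \<subseteq> closure X" "F \<subseteq> closure Y"
      "w \<bullet> p > c \<and> w \<bullet> r > c \<or> w \<bullet> p < c \<and> w \<bullet> r < c" for X Y p r
    using that(9)
  proof
    assume "w \<bullet> p > c \<and> w \<bullet> r > c"
    then show ?thesis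
      using open_convex_same_side_overlap[of X p c w Y r F] that F dimF by blast
  next
    assume "w \<bullet> p < c \<and> w \<bullet> r < c"
    then show ?thesis
      using open_convex_same_side_overlap[of X p "- c" "- w" Y r F] that F(1) neg dimF by simp
  qed
  have "w \<bullet> x > c \<and> w \<bullet> y > c \<or> w \<bullet> x < c \<and> w \<bullet> y < c
      \<or> w \<bullet> x > c \<and> w \<bullet> z > c \<or> w \<bullet> x < c \<and> w \<bullet> z < c
      \<or> w \<bullet> y > c \<and> w \<bullet> z > c \<or> w \<bullet> y < c \<and> w \<bullet> z < c"
    using pts by linarith
  then show ?thesis
    using same[of A x B y] same[of A x C z] same[of B y C z] opn cvx pts F by blast
qed

section \<open>Sums over the faces of an admissible mesh\<close>

locale bounded_mesh =
  fixes \<Omega> :: "'a::euclidean_space set" and m :: "'a mesh"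
  assumes mesh: "admissible_mesh \<Omega> m" and domain_bounded: "bounded \<Omega>"
begin

lemma finite_cells: "finite (cells m)"
  using mesh by (simp add: admissible_mesh_def)

lemma cellD:
  assumes "K \<in> cells m"
  shows "open K" "convex K" "K \<noteq> {}" "bounded (closure K)"
proof -
  show "open K" "convex K" "K \<noteq> {}" using mesh assms by (auto simp: admissible_mesh_def)
  have "(\<Union>K\<in>cells m. closure K) = closure \<Omega>" using mesh by (simp add: admissible_mesh_def)
  then have "closure K \<subseteq> closure \<Omega>" using assms by blast
  then show "bounded (closure K)" using domain_bounded bounded_closure bounded_subset by blast
qed

lemma cells_disjoint: "K \<in> cells m \<Longrightarrow> L \<in> cells m \<Longrightarrow> K \<noteq> L \<Longrightarrow> K \<inter> L = {}"
  using mesh by (auto simp: admissible_mesh_def disjoint_def)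

lemma cell_measure_pos:
  assumes "K \<in> cells m"
  shows "0 < cell_measure K"
proof -
  have "K \<in> lmeasurable"
    using cellD[OF assms] bounded_subset[OF cellD(4)[OF assms] closure_subset]
    by (intro lmeasurable_open)
  moreover have "\<not> negligible K" using cellD[OF assms] by (intro open_not_negligible)
  ultimately show ?thesis
    using negligible_iff_measure0[of K] measure_nonneg[of lebesgue K] unfolding cell_measure_def by linarith
qed

lemma is_interface_commute: "is_interface m K L \<sigma> \<longleftrightarrow> is_interface m L K \<sigma>"
  by (auto simp: is_interface_def)

lemma face_not_null: "\<sigma> \<in> faces m \<Longrightarrow> hausdorff_measure (DIM('a) - 1) \<sigma> \<noteq> 0"
  using mesh by (auto simp: admissible_mesh_def face_measure_def)

lemma interface_in_cell_faces:
  assumes "is_interface m K L \<sigma>"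
  shows "\<sigma> \<in> cell_faces m K" "\<sigma> \<in> cell_faces m L"
proof -
  have "\<forall>K\<in>cells m. \<forall>L\<in>cells m. K \<noteq> L \<longrightarrow>
      closure K \<inter> closure L \<in> cell_faces m K \<inter> cell_faces m L
      \<or> hausdorff_measure (DIM('a) - 1) (closure K \<inter> closure L) = 0"
    using mesh by (simp add: admissible_mesh_def)
  then have "\<sigma> \<in> cell_faces m K \<inter> cell_faces m L"
    using assms face_not_null[of \<sigma>] by (auto simp: is_interface_def)
  then show "\<sigma> \<in> cell_faces m K" "\<sigma> \<in> cell_faces m L" by auto
qed

text \<open>Why an interior face has exactly two sides. A face lies in a hyperplane and has positive
  \<open>(d-1)\<close>-dimensional measure, so it has full dimension there; a third adjacent cell would then overlap
  one of the other two. Without this fact neither \<^const>\<open>opposite_cell\<close> nor the rearrangement of sums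
  over cells into sums over interior faces would be meaningful.\<close>
lemma interface_third_cell:
  assumes KL: "is_interface m K L \<sigma>" and M: "M \<in> cells m" "\<sigma> \<in> cell_faces m M"
  shows "M = K \<or> M = L"
proof (rule ccontr)
  assume MKL: "\<not> ?thesis"
  have \<sigma>: "K \<in> cells m" "L \<in> cells m" "K \<noteq> L" "\<sigma> \<in> faces m" "\<sigma> = closure K \<inter> closure L"
    using KL by (auto simp: is_interface_def)
  obtain w c where w: "w \<noteq> 0" "\<sigma> \<subseteq> {x. w \<bullet> x = c}"
    using mesh \<sigma>(4) unfolding admissible_mesh_def by meson
  have "frontier M = \<Union> (cell_faces m M)" using mesh M(1) unfolding admissible_mesh_def by meson
  then have \<sigma>M: "\<sigma> \<subseteq> closure M" using M(2) by (auto simp: frontier_def)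
  have cvx: "convex \<sigma>" unfolding \<sigma>(5) using cellD \<sigma> by (intro convex_Int convex_closure) auto
  have "aff_dim \<sigma> \<le> aff_dim {x. w \<bullet> x = c}" using w(2) by (rule aff_dim_subset)
  then have "aff_dim \<sigma> \<le> int (DIM('a) - 1)" using w(1) by (simp add: aff_dim_hyperplane)
  moreover have "\<not> aff_dim \<sigma> < int (DIM('a) - 1)"
  proof
    assume "aff_dim \<sigma> < int (DIM('a) - 1)"
    moreover have "bounded \<sigma>" using cellD(4)[of K] \<sigma> by (auto intro: bounded_subset)
    ultimately show False
      using hausdorff_measure_eq_0_if_aff_dim_less face_not_null \<sigma>(4) by blast
  qed
  ultimately have "aff_dim \<sigma> = int DIM('a) - 1"
    using DIM_positive[where 'a='a] by (simp add: of_nat_diff)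
  then have "K \<inter> L \<noteq> {} \<or> K \<inter> M \<noteq> {} \<or> L \<inter> M \<noteq> {}"
    using three_open_convex_overlap[of K L M \<sigma> w c] cellD \<sigma> M(1) w cvx \<sigma>M by blast
  then show False using cells_disjoint \<sigma> M(1) MKL by metis
qed

lemma opposite_cell_eq:
  assumes "is_interface m K L \<sigma>"
  shows "opposite_cell m K \<sigma> = L"
  unfolding opposite_cell_def
proof (rule the_equality)
  show "is_interface m K L \<sigma>" by (rule assms)
next
  fix L' assume "is_interface m K L' \<sigma>"
  then show "L' = L"
    using interface_third_cell[OF assms, of L'] interface_in_cell_faces[of K L' \<sigma>]
    by (auto simp: is_interface_def)
qed

lemma adjacent_opposite_interface:
  assumes "\<sigma> \<in> int_faces m"
  shows "is_interface m (adjacent_cell m \<sigma>) (opposite_cell m (adjacent_cell m \<sigma>) \<sigma>) \<sigma>"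
proof -
  have "\<exists>K L. is_interface m K L \<sigma>" using assms by (simp add: int_faces_def)
  then have "\<exists>L. is_interface m (adjacent_cell m \<sigma>) L \<sigma>"
    unfolding adjacent_cell_def by (rule someI_ex)
  then show ?thesis using opposite_cell_eq by metis
qed

lemma finite_int_faces: "finite (int_faces m)"
proof (rule finite_subset)
  show "int_faces m \<subseteq> (\<lambda>(K, L). closure K \<inter> closure L) ` (cells m \<times> cells m)"
    by (auto simp: int_faces_def is_interface_def)
qed (simp add: finite_cells)

lemma sum_cells_int_faces:
  fixes f :: "'a set \<Rightarrow> 'a set \<Rightarrow> real"
  shows "(\<Sum>K\<in>cells m. \<Sum>\<sigma>\<in>int_cell_faces m K. f K \<sigma>)
    = (\<Sum>\<sigma>\<in>int_faces m. f (adjacent_cell m \<sigma>) \<sigma> + f (opposite_cell m (adjacent_cell m \<sigma>) \<sigma>) \<sigma>)"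
proof -
  have "(\<Sum>K\<in>cells m. \<Sum>\<sigma>\<in>int_cell_faces m K. f K \<sigma>)
      = (\<Sum>K\<in>cells m. \<Sum>\<sigma>\<in>{\<sigma>. \<sigma> \<in> int_faces m \<and> \<sigma> \<in> cell_faces m K}. f K \<sigma>)"
    by (intro sum.cong) (auto simp: int_cell_faces_def)
  also have "\<dots> = (\<Sum>\<sigma>\<in>int_faces m. \<Sum>K\<in>{K. K \<in> cells m \<and> \<sigma> \<in> cell_faces m K}. f K \<sigma>)"
    by (rule sum.swap_restrict[OF finite_cells finite_int_faces])
  also have "\<dots> = (\<Sum>\<sigma>\<in>int_faces m. f (adjacent_cell m \<sigma>) \<sigma> + f (opposite_cell m (adjacent_cell m \<sigma>) \<sigma>) \<sigma>)"
  proof (rule sum.cong[OF refl])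
    fix \<sigma> assume "\<sigma> \<in> int_faces m"
    note i = adjacent_opposite_interface[OF this]
    define K L where "K = adjacent_cell m \<sigma>" and "L = opposite_cell m K \<sigma>"
    note i = i[folded K_def, folded L_def]
    have "{K. K \<in> cells m \<and> \<sigma> \<in> cell_faces m K} = {K, L}"
      using i interface_third_cell[OF i] interface_in_cell_faces[OF i] by (auto simp: is_interface_def)
    moreover have "K \<noteq> L" using i by (auto simp: is_interface_def)
    ultimately show "(\<Sum>K\<in>{K. K \<in> cells m \<and> \<sigma> \<in> cell_faces m K}. f K \<sigma>)
        = f (adjacent_cell m \<sigma>) \<sigma> + f (opposite_cell m (adjacent_cell m \<sigma>) \<sigma>) \<sigma>"
      by (simp add: K_def[symmetric] L_def[symmetric])
  qed
  finally show ?thesis .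
qed

lemma face_value_interface: "is_interface m K L \<sigma> \<Longrightarrow> face_value m V K \<sigma> = V L"
  unfolding face_value_def using opposite_cell_eq by auto

lemma face_diff_interface: "is_interface m K L \<sigma> \<Longrightarrow> face_diff m V K \<sigma> = V L - V K"
  by (simp add: face_diff_def face_value_interface)

text \<open>Each interior face is visited from both of its cells, where a conservative flux \<open>J\<close> takes opposite values,
  so that only the jump of \<open>V\<close> across the face remains.\<close>
lemma discrete_integration_by_parts:
  assumes anti: "\<And>K L \<sigma>. is_interface m K L \<sigma> \<Longrightarrow> J L \<sigma> = - J K \<sigma>"
  shows "(\<Sum>K\<in>cells m. V K * (\<Sum>\<sigma>\<in>int_cell_faces m K. J K \<sigma>))
    = - (\<Sum>\<sigma>\<in>int_faces m. J (adjacent_cell m \<sigma>) \<sigma> * face_diff m V (adjacent_cell m \<sigma>) \<sigma>)"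
proof -
  have "(\<Sum>K\<in>cells m. V K * (\<Sum>\<sigma>\<in>int_cell_faces m K. J K \<sigma>))
      = (\<Sum>\<sigma>\<in>int_faces m. V (adjacent_cell m \<sigma>) * J (adjacent_cell m \<sigma>) \<sigma>
          + V (opposite_cell m (adjacent_cell m \<sigma>) \<sigma>) * J (opposite_cell m (adjacent_cell m \<sigma>) \<sigma>) \<sigma>)"
    unfolding sum_distrib_left by (rule sum_cells_int_faces)
  also have "\<dots> = (\<Sum>\<sigma>\<in>int_faces m. - (J (adjacent_cell m \<sigma>) \<sigma> * face_diff m V (adjacent_cell m \<sigma>) \<sigma>))"
  proof (rule sum.cong[OF refl])
    fix \<sigma> assume "\<sigma> \<in> int_faces m"
    note i = adjacent_opposite_interface[OF this]
    show "V (adjacent_cell m \<sigma>) * J (adjacent_cell m \<sigma>) \<sigma>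
        + V (opposite_cell m (adjacent_cell m \<sigma>) \<sigma>) * J (opposite_cell m (adjacent_cell m \<sigma>) \<sigma>) \<sigma>
        = - (J (adjacent_cell m \<sigma>) \<sigma> * face_diff m V (adjacent_cell m \<sigma>) \<sigma>)"
      unfolding anti[OF i] face_diff_interface[OF i] by (simp add: algebra_simps)
  qed
  finally show ?thesis by (simp add: sum_negf)
qed

lemma face_diff_commute:
  assumes "is_interface m K L \<sigma>"
  shows "face_diff m V L \<sigma> = - face_diff m V K \<sigma>"
  using face_diff_interface assms is_interface_commute[of K L \<sigma>] by simp

end

section \<open>Scalar inequalities and the mobility matrix\<close>

lemma transmissibility_nonneg: "0 \<le> transmissibility m \<sigma>"
  by (simp add: transmissibility_def face_measure_def Let_def)

lemma log_mean_nonneg: "0 \<le> log_mean a b"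
proof (cases "min a b \<le> 0 \<or> a = b")
  case False
  then have "0 < a" "0 < b" "a < b \<or> b < a" by auto
  then show ?thesis
    by (auto simp: log_mean_def intro: divide_nonpos_nonpos)
qed (auto simp: log_mean_def)

lemma log_mean_commute: "log_mean a b = log_mean b a"
  using minus_divide_divide[of "a - b" "ln a - ln b"] by (auto simp: log_mean_def min.commute)

text \<open>The chain rule \<open>u * (ln u)' = u'\<close> survives discretisation because edge values are logarithmic means.\<close>
lemma log_mean_mult_ln:
  assumes "0 < a" "0 < b"
  shows "log_mean a b * (ln b - ln a) = b - a"
  using assms by (auto simp: log_mean_def field_simps)

text \<open>The entropy density is convex and has derivative \<open>ln\<close>; its tangent at the new value \<open>b\<close> lies below it.\<close>
lemma entropy_increment_le:
  fixes a b :: real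
  assumes "0 < a" "0 < b"
  shows "(b * ln b - b + 1) - (a * ln a - a + 1) \<le> (b - a) * ln b"
proof -
  have "ln (b / a) \<le> b / a - 1" using assms by (intro ln_le_minus_one) simp
  then have "a * (ln b - ln a) \<le> a * (b / a - 1)" using assms by (simp add: ln_div)
  also have "\<dots> = b - a" using assms by (simp add: field_simps)
  finally show ?thesis by (simp add: algebra_simps)
qed

lemma mobility_mult:
  assumes "i \<le> n"
  shows "(\<Sum>j=0..n. mobility n \<kappa> u i j * z j) = (\<Sum>j\<in>{0..n} - {i}. \<kappa> i j * u i * u j * (z i - z j))"
proof -
  have "(\<Sum>j=0..n. mobility n \<kappa> u i j * z j)
      = (\<Sum>k\<in>{0..n} - {i}. \<kappa> i k * u i * u k) * z i + (\<Sum>j\<in>{0..n} - {i}. - \<kappa> i j * u i * u j * z j)"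
    using assms by (subst sum.remove[of _ i]) (auto simp: mobility_def intro!: sum.cong)
  also have "\<dots> = (\<Sum>j\<in>{0..n} - {i}. \<kappa> i j * u i * u j * (z i - z j))"
    unfolding sum_distrib_right sum.distrib[symmetric]
    by (intro sum.cong refl) (simp add: algebra_simps)
  finally show ?thesis .
qed

text \<open>The rows of the mobility matrix sum to zero, so its quadratic form only sees differences of components;
  symmetrising in \<open>i\<close> and \<open>j\<close> makes it a sum of squares.\<close>
lemma quad_form_mobility:
  assumes sym: "\<And>i j. i \<le> n \<Longrightarrow> j \<le> n \<Longrightarrow> i \<noteq> j \<Longrightarrow> \<kappa> i j = \<kappa> j i"
  shows "2 * quad_form n (mobility n \<kappa> u) z
    = (\<Sum>i=0..n. \<Sum>j\<in>{0..n} - {i}. \<kappa> i j * u i * u j * (z i - z j)\<^sup>2)"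
proof -
  define a where "a = (\<lambda>i j. if i = j then 0 else \<kappa> i j * u i * u j)"
  have off: "(\<Sum>j\<in>{0..n} - {i}. \<kappa> i j * u i * u j * f j) = (\<Sum>j=0..n. a i j * f j)" for i f
    by (rule sum.mono_neutral_cong_left) (auto simp: a_def)
  have q: "quad_form n (mobility n \<kappa> u) z = (\<Sum>i=0..n. \<Sum>j=0..n. a i j * (z i * (z i - z j)))"
    unfolding quad_form_def
  proof (rule sum.cong[OF refl])
    fix i assume "i \<in> {0..n}"
    then have i: "i \<le> n" by simp
    have "(\<Sum>j=0..n. z i * mobility n \<kappa> u i j * z j) = z i * (\<Sum>j=0..n. mobility n \<kappa> u i j * z j)"
      by (simp add: sum_distrib_left mult.assoc)
    also note mobility_mult[OF i]
    finally show "(\<Sum>j=0..n. z i * mobility n \<kappa> u i j * z j) = (\<Sum>j=0..n. a i j * (z i * (z i - z j)))"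
      by (simp add: off sum_distrib_left mult.left_commute)
  qed
  also have "\<dots> = (\<Sum>i=0..n. \<Sum>j=0..n. a j i * (z j * (z j - z i)))" by (rule sum.swap)
  also have "\<dots> = (\<Sum>i=0..n. \<Sum>j=0..n. a i j * (z j * (z j - z i)))"
    using sym by (intro sum.cong refl) (auto simp: a_def)
  finally have "2 * quad_form n (mobility n \<kappa> u) z
      = (\<Sum>i=0..n. \<Sum>j=0..n. a i j * (z i * (z i - z j)))
        + (\<Sum>i=0..n. \<Sum>j=0..n. a i j * (z j * (z j - z i)))"
    using q by simp
  also have "\<dots> = (\<Sum>i=0..n. \<Sum>j=0..n. a i j * (z i - z j)\<^sup>2)"
    unfolding sum.distrib[symmetric]
    by (intro sum.cong refl) (simp add: power2_eq_square algebra_simps)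
  finally show ?thesis by (simp add: off)
qed

lemma mobility_pos_semidef:
  assumes \<kappa>: "\<And>i j. i \<le> n \<Longrightarrow> j \<le> n \<Longrightarrow> i \<noteq> j \<Longrightarrow> \<kappa> i j = \<kappa> j i \<and> 0 \<le> \<kappa> i j"
    and u: "\<And>i. i \<le> n \<Longrightarrow> 0 \<le> u i"
  shows "pos_semidef n (mobility n \<kappa> u)"
proof -
  have "0 \<le> quad_form n (mobility n \<kappa> u) z" for z
  proof -
    have "0 \<le> (\<Sum>i=0..n. \<Sum>j\<in>{0..n} - {i}. \<kappa> i j * u i * u j * (z i - z j)\<^sup>2)"
      using \<kappa> u by (intro sum_nonneg mult_nonneg_nonneg) auto
    then show ?thesis using quad_form_mobility[of n \<kappa> u z] \<kappa> by simp
  qed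
  moreover have "mobility n \<kappa> u i j = mobility n \<kappa> u j i" if "i \<le> n" "j \<le> n" for i j
    using \<kappa>[of i j] that by (simp add: mobility_def)
  ultimately show ?thesis by (simp add: pos_semidef_def)
qed

section \<open>Positivity of the iterates\<close>

locale scheme_data = bounded_mesh \<Omega> m
  for \<Omega> :: "'a::euclidean_space set" and m :: "'a mesh" +
  fixes n :: nat and \<kappa> :: "nat \<Rightarrow> nat \<Rightarrow> real" and \<epsilon> \<beta> :: real
  assumes \<kappa>: "\<And>i j. i \<le> n \<Longrightarrow> j \<le> n \<Longrightarrow> i \<noteq> j \<Longrightarrow> \<kappa> i j = \<kappa> j i \<and> 0 < \<kappa> i j"
    and \<epsilon>: "0 < \<epsilon>" and \<beta>: "0 < \<beta>"
begin

text \<open>A minimum principle. Were the minimum of a component over the cells not positive, all edge values of that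
  component around a minimising cell would vanish. What is left of the flux out of this cell points inward,
  so the cell can only have gained mass, although it started from a positive value.\<close>
lemma scheme_step_positive:
  assumes dt: "0 < dt" and pos: "positive_state m n U"
    and step: "scheme_step m n \<kappa> \<epsilon> \<beta> dt U U'"
  shows "positive_state m n U'"
proof (rule ccontr)
  assume "\<not> ?thesis"
  then obtain i K\<^sub>0 where i: "i \<le> n" and K\<^sub>0: "K\<^sub>0 \<in> cells m" "U' i K\<^sub>0 \<le> 0"
    by (auto simp: positive_state_def not_less)
  obtain K where K: "K \<in> cells m" and min: "\<And>L. L \<in> cells m \<Longrightarrow> U' i K \<le> U' i L"
    using ex_is_arg_min_if_finite[OF finite_cells, of "U' i"] K\<^sub>0(1)
    by (auto simp: is_arg_min_linorder)
  have neg: "U' i K \<le> 0" using min[OF K\<^sub>0(1)] K\<^sub>0(2) by simp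
  have "flux m n \<kappa> \<epsilon> \<beta> U U' i K \<sigma> \<le> 0" for \<sigma>
  proof -
    have e0: "edge_value m (U' i) K \<sigma> = 0" using neg by (simp add: edge_value_def log_mean_def)
    have "U' i K \<le> face_value m (U' i) K \<sigma>"
    proof (cases "\<exists>L. is_interface m K L \<sigma>")
      case True
      then obtain L where L: "is_interface m K L \<sigma>" by blast
      then have "L \<in> cells m" by (simp add: is_interface_def)
      then show ?thesis
        using face_value_interface[OF L] min by simp
    qed (simp add: face_value_def)
    then have D: "0 \<le> face_diff m (U' i) K \<sigma>" by (simp add: face_diff_def)
    have u: "0 \<le> edge_value m (U' j) K \<sigma>" for j by (simp add: edge_value_def log_mean_nonneg)
    show ?thesis
    proof (cases "i = 0")
      case True
      have "0 \<le> \<kappa> j 0" if "j \<in> {1..n}" for j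
        using \<kappa>[of j 0] that by (intro less_imp_le) auto
      then have "0 \<le> (\<Sum>j=1..n. \<kappa> j 0 * (edge_value m (U' j) K \<sigma> * face_diff m (U' 0) K \<sigma>))"
        using u D True by (intro sum_nonneg mult_nonneg_nonneg) auto
      then show ?thesis
        using e0 True transmissibility_nonneg[of m \<sigma>] by (simp add: flux_def)
    next
      case False
      have "0 \<le> \<kappa> i j" if "j \<in> {0..n} - {i}" for j
        using \<kappa>[of i j] i that by (intro less_imp_le) auto
      then have "0 \<le> (\<Sum>j\<in>{0..n} - {i}. \<kappa> i j * (edge_value m (U' j) K \<sigma> * face_diff m (U' i) K \<sigma>))"
        using u D by (intro sum_nonneg mult_nonneg_nonneg) auto
      then show ?thesis
        using e0 False transmissibility_nonneg[of m \<sigma>] by (simp add: flux_def)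
    qed
  qed
  then have "(\<Sum>\<sigma>\<in>int_cell_faces m K. flux m n \<kappa> \<epsilon> \<beta> U U' i K \<sigma>) \<le> 0"
    by (intro sum_nonpos)
  moreover have "cell_measure K * ((U' i K - U i K) / dt)
      + (\<Sum>\<sigma>\<in>int_cell_faces m K. flux m n \<kappa> \<epsilon> \<beta> U U' i K \<sigma>) = 0"
    using step K i by (simp add: scheme_step_def)
  moreover have "cell_measure K * ((U' i K - U i K) / dt) < 0"
  proof -
    have "0 < U i K" using pos K i by (simp add: positive_state_def)
    then have "(U' i K - U i K) / dt < 0" using neg dt by (simp add: divide_neg_pos)
    with cell_measure_pos[OF K] show ?thesis by (rule mult_pos_neg)
  qed
  ultimately show False by linarith
qed

section \<open>Work and dissipation\<close>

text \<open>The scheme has a gradient-flow structure: by the chain rule for logarithmic means, the cross-diffusion part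
  and the potential part of the flux combine into the mobility matrix applied to the jumps of the chemical
  potentials.\<close>
lemma flux_eq_mobility:
  assumes pos: "positive_state m n U'" and KL: "is_interface m K L \<sigma>" and i: "i \<le> n"
  shows "flux m n \<kappa> \<epsilon> \<beta> U U' i K \<sigma>
    = - transmissibility m \<sigma> * (\<Sum>j=0..n. mobility n \<kappa> (\<lambda>j. edge_value m (U' j) K \<sigma>) i j
          * face_diff m (chem_potential m \<epsilon> \<beta> U U' j) K \<sigma>)"
proof -
  define u where "u = (\<lambda>j. edge_value m (U' j) K \<sigma>)"
  define D where "D = (\<lambda>j. face_diff m (U' j) K \<sigma>)"
  define l where "l = (\<lambda>j. ln (U' j L) - ln (U' j K))"
  define DW where "DW = face_diff m (potential_W m \<epsilon> \<beta> U U') K \<sigma>"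
  note fd = face_diff_interface[OF KL]
  have D: "D j = u j * l j" if "j \<le> n" for j
  proof -
    have "0 < U' j K" "0 < U' j L"
      using pos KL that by (auto simp: positive_state_def is_interface_def)
    then show ?thesis
      by (simp add: D_def u_def l_def fd edge_value_def face_value_interface[OF KL] log_mean_mult_ln)
  qed
  have \<mu>: "face_diff m (chem_potential m \<epsilon> \<beta> U U' j) K \<sigma> = l j + (if j = 0 then DW else 0)" for j
    by (simp add: fd l_def DW_def chem_potential_def)
  have "flux m n \<kappa> \<epsilon> \<beta> U U' i K \<sigma> = - transmissibility m \<sigma> *
      (\<Sum>j\<in>{0..n} - {i}. \<kappa> i j * u i * u j * ((l i + (if i = 0 then DW else 0)) - (l j + (if j = 0 then DW else 0))))"
  proof (cases "i = 0")
    case True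
    have "flux m n \<kappa> \<epsilon> \<beta> U U' i K \<sigma> = - transmissibility m \<sigma> *
        ((\<Sum>j=1..n. \<kappa> j 0 * (u j * D 0 - u 0 * D j)) + (\<Sum>j=1..n. \<kappa> j 0 * u j * u 0 * DW))"
      using True by (simp add: flux_def Let_def u_def D_def DW_def distrib_left)
    also have "(\<Sum>j=1..n. \<kappa> j 0 * (u j * D 0 - u 0 * D j)) + (\<Sum>j=1..n. \<kappa> j 0 * u j * u 0 * DW)
        = (\<Sum>j\<in>{0..n} - {0}. \<kappa> 0 j * u 0 * u j * (l 0 + DW - l j))"
      unfolding sum.distrib[symmetric]
      using \<kappa>[of 0] by (intro sum.cong) (auto simp: D algebra_simps)
    also have "\<dots> = (\<Sum>j\<in>{0..n} - {0}. \<kappa> 0 j * u 0 * u j * (l 0 + DW - (l j + (if j = 0 then DW else 0))))"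
      by (intro sum.cong) auto
    finally show ?thesis using True by simp
  next
    case False
    have "flux m n \<kappa> \<epsilon> \<beta> U U' i K \<sigma> = - transmissibility m \<sigma> *
        ((\<Sum>j\<in>{0..n} - {i}. \<kappa> i j * (u j * D i - u i * D j)) - \<kappa> i 0 * u i * u 0 * DW)"
      using False by (simp add: flux_def Let_def u_def D_def DW_def right_diff_distrib)
    also have "\<kappa> i 0 * u i * u 0 * DW = (\<Sum>j\<in>{0..n} - {i}. if j = 0 then \<kappa> i 0 * u i * u 0 * DW else 0)"
      using False by (simp add: sum.delta)
    also have "(\<Sum>j\<in>{0..n} - {i}. \<kappa> i j * (u j * D i - u i * D j)) - \<dots>
        = (\<Sum>j\<in>{0..n} - {i}. \<kappa> i j * u i * u j * (l i - (l j + (if j = 0 then DW else 0))))"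
      unfolding sum_subtractf[symmetric]
      using i by (intro sum.cong) (auto simp: D algebra_simps)
    finally show ?thesis using False by simp
  qed
  then show ?thesis using mobility_mult[OF i, of \<kappa> u] by (simp add: \<mu> u_def)
qed

lemma edge_value_commute:
  assumes "is_interface m K L \<sigma>"
  shows "edge_value m V L \<sigma> = edge_value m V K \<sigma>"
  using face_value_interface assms is_interface_commute[of K L \<sigma>]
  by (simp add: edge_value_def log_mean_commute)

lemma flux_conservative:
  assumes "is_interface m K L \<sigma>"
  shows "flux m n \<kappa> \<epsilon> \<beta> U U' i L \<sigma> = - flux m n \<kappa> \<epsilon> \<beta> U U' i K \<sigma>"
proof -
  have neg: "c * (a * - x - b * - y) = - (c * (a * x - b * y))" for a b c x y :: real
    by (simp add: algebra_simps)
  show ?thesis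
    unfolding flux_def Let_def edge_value_commute[OF assms] face_diff_commute[OF assms] neg
    by (simp add: sum_negf)
qed

text \<open>Multiply the scheme by the chemical potentials and sum by parts: across each interior face the flux, which is
  linear in the jumps of the potentials, is paired with these same jumps, and this gives the quadratic form of the
  mobility.\<close>
lemma work_eq_dissipation:
  assumes dt: "0 < dt" and pos: "positive_state m n U'"
    and step: "scheme_step m n \<kappa> \<epsilon> \<beta> dt U U'"
  shows "(\<Sum>i=0..n. \<Sum>K\<in>cells m. cell_measure K * (U' i K - U i K) * chem_potential m \<epsilon> \<beta> U U' i K)
    = - dt * discrete_dissipation m n \<kappa> \<epsilon> \<beta> U U'"
proof -
  let ?\<mu> = "chem_potential m \<epsilon> \<beta> U U'" and ?J = "flux m n \<kappa> \<epsilon> \<beta> U U'" and ?A = "adjacent_cell m"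
  let ?D = "\<lambda>i \<sigma>. face_diff m (?\<mu> i) (?A \<sigma>) \<sigma>"
  have work: "(\<Sum>K\<in>cells m. cell_measure K * (U' i K - U i K) * ?\<mu> i K)
      = dt * (\<Sum>\<sigma>\<in>int_faces m. ?J i (?A \<sigma>) \<sigma> * ?D i \<sigma>)" if i: "i \<le> n" for i
  proof -
    have "cell_measure K * (U' i K - U i K) = - dt * (\<Sum>\<sigma>\<in>int_cell_faces m K. ?J i K \<sigma>)"
      if "K \<in> cells m" for K
    proof -
      have "cell_measure K * ((U' i K - U i K) / dt) = - (\<Sum>\<sigma>\<in>int_cell_faces m K. ?J i K \<sigma>)"
        using step that i by (simp add: scheme_step_def eq_neg_iff_add_eq_0)
      then show ?thesis using dt by (simp add: field_simps)
    qed
    then have "(\<Sum>K\<in>cells m. cell_measure K * (U' i K - U i K) * ?\<mu> i K)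
        = - dt * (\<Sum>K\<in>cells m. ?\<mu> i K * (\<Sum>\<sigma>\<in>int_cell_faces m K. ?J i K \<sigma>))"
      by (simp add: sum_distrib_left mult_ac)
    also have "(\<Sum>K\<in>cells m. ?\<mu> i K * (\<Sum>\<sigma>\<in>int_cell_faces m K. ?J i K \<sigma>))
        = - (\<Sum>\<sigma>\<in>int_faces m. ?J i (?A \<sigma>) \<sigma> * ?D i \<sigma>)"
      by (rule discrete_integration_by_parts[OF flux_conservative])
    finally show ?thesis by simp
  qed
  have diss: "(\<Sum>i=0..n. ?J i (?A \<sigma>) \<sigma> * ?D i \<sigma>)
      = - (transmissibility m \<sigma> * quad_form n (mobility n \<kappa> (edge_state m U' \<sigma>)) (\<lambda>i. ?D i \<sigma>))"
    if "\<sigma> \<in> int_faces m" for \<sigma>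
  proof -
    note flux_eq_mobility[OF pos adjacent_opposite_interface[OF that]]
    then have "(\<Sum>i=0..n. ?J i (?A \<sigma>) \<sigma> * ?D i \<sigma>)
        = (\<Sum>i=0..n. - transmissibility m \<sigma> *
            (\<Sum>j=0..n. mobility n \<kappa> (edge_state m U' \<sigma>) i j * ?D j \<sigma>) * ?D i \<sigma>)"
      by (intro sum.cong refl) (simp add: edge_state_def[abs_def])
    then show ?thesis
      by (simp add: quad_form_def sum_distrib_left sum_distrib_right sum_negf mult_ac)
  qed
  have "(\<Sum>i=0..n. \<Sum>K\<in>cells m. cell_measure K * (U' i K - U i K) * ?\<mu> i K)
      = dt * (\<Sum>i=0..n. \<Sum>\<sigma>\<in>int_faces m. ?J i (?A \<sigma>) \<sigma> * ?D i \<sigma>)"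
    using work by (simp add: sum_distrib_left)
  also have "(\<Sum>i=0..n. \<Sum>\<sigma>\<in>int_faces m. ?J i (?A \<sigma>) \<sigma> * ?D i \<sigma>)
      = (\<Sum>\<sigma>\<in>int_faces m. \<Sum>i=0..n. ?J i (?A \<sigma>) \<sigma> * ?D i \<sigma>)" by (rule sum.swap)
  also have "\<dots> = - discrete_dissipation m n \<kappa> \<epsilon> \<beta> U U'"
    by (simp add: diss discrete_dissipation_def sum_negf)
  finally show ?thesis by simp
qed

section \<open>The energy increment\<close>

text \<open>\<^const>\<open>potential_W\<close> is implicit in the convex gradient term and explicit in the concave term
  \<open>\<beta> V (1 - V)\<close>. With this splitting both tangent inequalities go in the same direction: each part increases
  at most by its linearisation, taken at the new state for the convex and at the old state for the concave
  part. The linearised gradient term takes the form of \<^const>\<open>potential_W\<close> after discrete integration by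
  parts.\<close>
lemma phase_energy_increment_le:
  defines "P \<equiv> (\<lambda>V. \<epsilon> / 2 * (\<Sum>\<sigma>\<in>int_faces m. transmissibility m \<sigma> * \<bar>face_diff m V (adjacent_cell m \<sigma>) \<sigma>\<bar>\<^sup>2)
     + \<beta> * (\<Sum>K\<in>cells m. cell_measure K * V K * (1 - V K)))"
  shows "P (U' 0) - P (U 0) \<le> (\<Sum>K\<in>cells m. cell_measure K * (U' 0 K - U 0 K) * potential_W m \<epsilon> \<beta> U U' K)"
proof -
  let ?A = "adjacent_cell m" and ?\<tau> = "transmissibility m"
  define V V' where "V = U 0" and "V' = U' 0"
  let ?D = "\<lambda>V \<sigma>. face_diff m V (?A \<sigma>) \<sigma>"
  have conv: "(\<Sum>\<sigma>\<in>int_faces m. ?\<tau> \<sigma> * \<bar>?D V' \<sigma>\<bar>\<^sup>2) - (\<Sum>\<sigma>\<in>int_faces m. ?\<tau> \<sigma> * \<bar>?D V \<sigma>\<bar>\<^sup>2)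
      \<le> 2 * (\<Sum>\<sigma>\<in>int_faces m. ?\<tau> \<sigma> * ?D V' \<sigma> * face_diff m (\<lambda>K. V' K - V K) (?A \<sigma>) \<sigma>)"
    unfolding sum_distrib_left sum_subtractf[symmetric]
  proof (rule sum_mono)
    fix \<sigma> assume \<sigma>: "\<sigma> \<in> int_faces m"
    define x y where "x = ?D V' \<sigma>" and "y = ?D V \<sigma>"
    have lin: "face_diff m (\<lambda>K. V' K - V K) (?A \<sigma>) \<sigma> = x - y"
      using face_diff_interface[OF adjacent_opposite_interface[OF \<sigma>]]
      by (simp add: x_def y_def)
    have "0 \<le> ?\<tau> \<sigma> * (x - y)\<^sup>2" using transmissibility_nonneg[of m \<sigma>] by simp
    then show "?\<tau> \<sigma> * \<bar>?D V' \<sigma>\<bar>\<^sup>2 - ?\<tau> \<sigma> * \<bar>?D V \<sigma>\<bar>\<^sup>2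
        \<le> 2 * (?\<tau> \<sigma> * ?D V' \<sigma> * face_diff m (\<lambda>K. V' K - V K) (?A \<sigma>) \<sigma>)"
      unfolding lin x_def[symmetric] y_def[symmetric] power2_abs
      by (simp add: power2_eq_square algebra_simps)
  qed
  have conc: "(\<Sum>K\<in>cells m. cell_measure K * V' K * (1 - V' K)) - (\<Sum>K\<in>cells m. cell_measure K * V K * (1 - V K))
      \<le> (\<Sum>K\<in>cells m. cell_measure K * (V' K - V K) * (1 - 2 * V K))"
    unfolding sum_subtractf[symmetric]
  proof (rule sum_mono)
    fix K assume "K \<in> cells m"
    then have "0 \<le> cell_measure K * (V' K - V K)\<^sup>2"
      using cell_measure_pos by (simp add: less_imp_le)
    then show "cell_measure K * V' K * (1 - V' K) - cell_measure K * V K * (1 - V K)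
        \<le> cell_measure K * (V' K - V K) * (1 - 2 * V K)"
      by (simp add: power2_eq_square algebra_simps)
  qed
  have "cell_measure K * (V' K - V K) * potential_W m \<epsilon> \<beta> U U' K
      = - \<epsilon> * ((V' K - V K) * (\<Sum>\<sigma>\<in>int_cell_faces m K. ?\<tau> \<sigma> * face_diff m V' K \<sigma>))
        + \<beta> * (cell_measure K * (V' K - V K) * (1 - 2 * V K))" if "K \<in> cells m" for K
  proof -
    have W: "cell_measure K * potential_W m \<epsilon> \<beta> U U' K
        = - \<epsilon> * (\<Sum>\<sigma>\<in>int_cell_faces m K. ?\<tau> \<sigma> * face_diff m V' K \<sigma>) + \<beta> * (cell_measure K * (1 - 2 * V K))"
      using cell_measure_pos[OF that]
      by (simp add: potential_W_def V_def V'_def field_simps)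
    have "cell_measure K * (V' K - V K) * potential_W m \<epsilon> \<beta> U U' K
        = (V' K - V K) * (cell_measure K * potential_W m \<epsilon> \<beta> U U' K)" by simp
    then show ?thesis unfolding W by (simp add: algebra_simps)
  qed
  then have "(\<Sum>K\<in>cells m. cell_measure K * (V' K - V K) * potential_W m \<epsilon> \<beta> U U' K)
      = - \<epsilon> * (\<Sum>K\<in>cells m. (V' K - V K) * (\<Sum>\<sigma>\<in>int_cell_faces m K. ?\<tau> \<sigma> * face_diff m V' K \<sigma>))
        + \<beta> * (\<Sum>K\<in>cells m. cell_measure K * (V' K - V K) * (1 - 2 * V K))"
    by (simp only: sum.distrib sum_distrib_left[symmetric] cong: sum.cong)
  also have "(\<Sum>K\<in>cells m. (V' K - V K) * (\<Sum>\<sigma>\<in>int_cell_faces m K. ?\<tau> \<sigma> * face_diff m V' K \<sigma>))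
      = - (\<Sum>\<sigma>\<in>int_faces m. ?\<tau> \<sigma> * ?D V' \<sigma> * face_diff m (\<lambda>K. V' K - V K) (?A \<sigma>) \<sigma>)"
    by (rule discrete_integration_by_parts) (simp add: face_diff_commute)
  finally show ?thesis
    using mult_left_mono[OF conv, of "\<epsilon> / 2"] mult_left_mono[OF conc, of \<beta>] \<epsilon> \<beta>
    by (simp add: P_def V_def V'_def algebra_simps)
qed

lemma energy_increment_le_work:
  assumes pos: "positive_state m n U" "positive_state m n U'"
  shows "discrete_energy m n \<epsilon> \<beta> U' - discrete_energy m n \<epsilon> \<beta> U
    \<le> (\<Sum>i=0..n. \<Sum>K\<in>cells m. cell_measure K * (U' i K - U i K) * chem_potential m \<epsilon> \<beta> U U' i K)"
proof -
  let ?h = "\<lambda>x::real. x * ln x - x + 1"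
  let ?c = "\<lambda>i K. cell_measure K * (U' i K - U i K)"
  have ent: "(\<Sum>i=0..n. \<Sum>K\<in>cells m. cell_measure K * ?h (U' i K))
      - (\<Sum>i=0..n. \<Sum>K\<in>cells m. cell_measure K * ?h (U i K))
      \<le> (\<Sum>i=0..n. \<Sum>K\<in>cells m. ?c i K * ln (U' i K))"
    unfolding sum_subtractf[symmetric]
  proof (intro sum_mono)
    fix i K assume "i \<in> {0..n}" and K: "K \<in> cells m"
    then have "?h (U' i K) - ?h (U i K) \<le> (U' i K - U i K) * ln (U' i K)"
      using pos by (intro entropy_increment_le) (auto simp: positive_state_def)
    then have "cell_measure K * (?h (U' i K) - ?h (U i K)) \<le> cell_measure K * ((U' i K - U i K) * ln (U' i K))"
      using cell_measure_pos[OF K] by (intro mult_left_mono) auto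
    then show "cell_measure K * ?h (U' i K) - cell_measure K * ?h (U i K) \<le> ?c i K * ln (U' i K)"
      by (simp add: algebra_simps)
  qed
  have "(\<Sum>i=0..n. \<Sum>K\<in>cells m. ?c i K * chem_potential m \<epsilon> \<beta> U U' i K)
      = (\<Sum>i=0..n. (\<Sum>K\<in>cells m. ?c i K * ln (U' i K))
          + (if i = 0 then \<Sum>K\<in>cells m. ?c 0 K * potential_W m \<epsilon> \<beta> U U' K else 0))"
    by (intro sum.cong refl) (simp add: chem_potential_def distrib_left sum.distrib)
  also have "\<dots> = (\<Sum>i=0..n. \<Sum>K\<in>cells m. ?c i K * ln (U' i K))
      + (\<Sum>K\<in>cells m. ?c 0 K * potential_W m \<epsilon> \<beta> U U' K)"
    by (simp add: sum.distrib)
  finally show ?thesis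
    using ent phase_energy_increment_le[of U' U] by (simp add: discrete_energy_def)
qed

section \<open>Energy dissipation\<close>

lemma energy_dissipation_inequality:
  assumes "0 < dt" "positive_state m n U" "scheme_step m n \<kappa> \<epsilon> \<beta> dt U U'"
  shows "discrete_energy m n \<epsilon> \<beta> U' - discrete_energy m n \<epsilon> \<beta> U
    + dt * discrete_dissipation m n \<kappa> \<epsilon> \<beta> U U' \<le> 0"
  using work_eq_dissipation[of dt U' U] energy_increment_le_work[of U U'] scheme_step_positive[of dt U U'] assms
  by simp

lemma edge_mobility_pos_semidef: "pos_semidef n (mobility n \<kappa> (edge_state m U \<sigma>))"
  using \<kappa> by (intro mobility_pos_semidef) (auto simp: edge_state_def edge_value_def log_mean_nonneg less_imp_le)

lemma discrete_dissipation_nonneg: "0 \<le> discrete_dissipation m n \<kappa> \<epsilon> \<beta> U U'"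
  unfolding discrete_dissipation_def
  using edge_mobility_pos_semidef[unfolded pos_semidef_def] transmissibility_nonneg
  by (intro sum_nonneg mult_nonneg_nonneg) auto

lemma energy_decreasing:
  assumes "0 < dt" "positive_state m n U" "scheme_step m n \<kappa> \<epsilon> \<beta> dt U U'"
  shows "discrete_energy m n \<epsilon> \<beta> U' \<le> discrete_energy m n \<epsilon> \<beta> U"
  using energy_dissipation_inequality[OF assms] assms(1) discrete_dissipation_nonneg[of U U']
    mult_nonneg_nonneg[of dt "discrete_dissipation m n \<kappa> \<epsilon> \<beta> U U'"]
  by linarith

lemma energy_le_initial:
  assumes "\<And>q. q < p \<Longrightarrow> 0 < dt q" "positive_state m n (U 0)"
    and "\<And>q. q < p \<Longrightarrow> scheme_step m n \<kappa> \<epsilon> \<beta> (dt q) (U q) (U (Suc q))"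
  shows "positive_state m n (U p) \<and> discrete_energy m n \<epsilon> \<beta> (U p) \<le> discrete_energy m n \<epsilon> \<beta> (U 0)"
  using assms
proof (induction p)
  case (Suc p)
  then have IH: "positive_state m n (U p)" "discrete_energy m n \<epsilon> \<beta> (U p) \<le> discrete_energy m n \<epsilon> \<beta> (U 0)"
    by auto
  show ?case
    using scheme_step_positive[of "dt p" "U p" "U (Suc p)"] energy_decreasing[of "dt p" "U p" "U (Suc p)"]
      IH Suc.prems by force
qed simp

end

theorem proposition4p5:
  fixes \<Omega> :: "(real ^ 'd) set"
    and m :: "(real ^ 'd) mesh"
    and n p :: nat
    and \<epsilon> \<beta> :: real
    and \<kappa> :: "nat \<Rightarrow> nat \<Rightarrow> real"
    and dt :: "nat \<Rightarrow> real"
    and U :: "nat \<Rightarrow> nat \<Rightarrow> (real ^ 'd) set \<Rightarrow> real"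
  assumes "CARD('d) \<in> {1, 2, 3}"
    and "bounded_domain \<Omega>"
    and "admissible_mesh \<Omega> m"
    and "n \<ge> 1"
    and "\<epsilon> > 0" and "\<beta> > 0"
    and "\<forall>i\<le>n. \<forall>j\<le>n. i \<noteq> j \<longrightarrow> \<kappa> i j = \<kappa> j i \<and> \<kappa> i j > 0"
    and "\<forall>q\<le>p. dt q > 0"
    and "positive_state m n (U p)"
    and "scheme_step m n \<kappa> \<epsilon> \<beta> (dt p) (U p) (U (Suc p))"
  shows "discrete_energy m n \<epsilon> \<beta> (U (Suc p)) - discrete_energy m n \<epsilon> \<beta> (U p)
           + dt p * discrete_dissipation m n \<kappa> \<epsilon> \<beta> (U p) (U (Suc p)) \<le> 0
       \<and> (\<forall>\<sigma>\<in>int_faces m. pos_semidef n (mobility n \<kappa> (edge_state m (U (Suc p)) \<sigma>)))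
       \<and> discrete_energy m n \<epsilon> \<beta> (U (Suc p)) \<le> discrete_energy m n \<epsilon> \<beta> (U p)
       \<and> (positive_state m n (U 0) \<and> (\<forall>q<p. scheme_step m n \<kappa> \<epsilon> \<beta> (dt q) (U q) (U (Suc q)))
           \<longrightarrow> discrete_energy m n \<epsilon> \<beta> (U p) \<le> discrete_energy m n \<epsilon> \<beta> (U 0))"
proof (intro conjI ballI impI)
  interpret scheme_data \<Omega> m n \<kappa> \<epsilon> \<beta>
    using assms(2,3,5-7) by unfold_locales (auto simp: bounded_domain_def)
  have dt: "0 < dt q" if "q \<le> p" for q using assms(8) that by blast
  show "discrete_energy m n \<epsilon> \<beta> (U (Suc p)) - discrete_energy m n \<epsilon> \<beta> (U p)
      + dt p * discrete_dissipation m n \<kappa> \<epsilon> \<beta> (U p) (U (Suc p)) \<le> 0"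
    using energy_dissipation_inequality[OF dt assms(9,10)] by simp
  show "pos_semidef n (mobility n \<kappa> (edge_state m (U (Suc p)) \<sigma>))" for \<sigma>
    by (rule edge_mobility_pos_semidef)
  show "discrete_energy m n \<epsilon> \<beta> (U (Suc p)) \<le> discrete_energy m n \<epsilon> \<beta> (U p)"
    using energy_decreasing[OF dt assms(9,10)] by simp
  assume "positive_state m n (U 0) \<and> (\<forall>q<p. scheme_step m n \<kappa> \<epsilon> \<beta> (dt q) (U q) (U (Suc q)))"
  then show "discrete_energy m n \<epsilon> \<beta> (U p) \<le> discrete_energy m n \<epsilon> \<beta> (U 0)"
    using energy_le_initial[of p dt U] dt by simp
qed

end
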